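(* Let $k_\mathcal{G}=n_\mathcal{G}-1\ge1$, $n_\mathcal{H}\in\{2,3\}$ and $k_\mathcal{H}=n_\mathcal{H}-1$. Let $s_0=\alpha+\beta\sum_{g\in V(\mathcal{G})}\sum_{h\in V(\mathcal{H})}x_{gh}+\gamma\sum_{g\in V(\mathcal{G})}\sum_{\{h,h'\}\subseteq V(\mathcal{H})}x_{gh}x_{gh'}$ and $s_g=\kappa\sum_{h\in V(\mathcal{H})}x_{gh}+\lambda\sum_{\{h,h'\}\subseteq V(\mathcal{H})}x_{gh}x_{gh'}$ for $g\in V(\mathcal{G})$, where for $n_\mathcal{H}=2$: $\alpha=n_\mathcal{G}-1$, $\beta=-1$, $\gamma=1$, $\kappa=0$, $\lambda=1$; and for $n_\mathcal{H}=3$: $\alpha=\sqrt2(n_\mathcal{G}-1)$, $\beta=-\frac23\sqrt2$, $\gamma=\frac13\sqrt2$, $\kappa=\frac13$, $\lambda=-\frac23$. Then $f_{\mathrm{viz}}\equiv s_0^2+\sum_{g\in V(\mathcal{G})}s_g^2\pmod{I_{\mathrm{viz}}}$, i.e. these form a degree-2 sum-of-squares certificate of $f_{\mathrm{viz}}$; consequently $\gamma(G)\gamma(H)\le\gamma(G\Box H)$ for all graphs $G$ on $n_\mathcal{G}$ vertices with domination number $n_\mathcal{G}-1$ and $H$ on $n_\mathcal{H}\in\{2,3\}$ vertices with domination number $n_\mathcal{H}-1$.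
   Context: $\mathbb{K}$ is a subfield of $\mathbb{R}$ containing $\sqrt2$ (e.g. $\mathbb{K}=\mathbb{R}$). $V(\mathcal{G})$ is a set of $n_\mathcal{G}$ vertices with fixed subset $D_\mathcal{G}$ of size $k_\mathcal{G}$; $V(\mathcal{H})$ a disjoint set of $n_\mathcal{H}$ vertices with fixed subset $D_\mathcal{H}$ of size $k_\mathcal{H}$. Variables $e_{gg'}=e_{g'g}$ for 2-subsets of $V(\mathcal{G})$, $e_{hh'}$ for 2-subsets of $V(\mathcal{H})$, $x_{gh}$ for $g\in V(\mathcal{G}),h\in V(\mathcal{H})$; $P$ is the polynomial ring over $\mathbb{K}$ in these. $I_{\mathrm{viz}}\subseteq P$ is generated by: $e_{gg'}^2-e_{gg'}$; $\prod_{g'\in D_\mathcal{G}}(1-e_{gg'})$ for $g\in V(\mathcal{G})\setminus D_\mathcal{G}$; $\prod_{g'\in V(\mathcal{G})\setminus S}\sum_{g\in S}e_{gg'}$ for $S\subseteq V(\mathcal{G})$, $|S|=k_\mathcal{G}-1$; the same three families for $\mathcal{H}$; $x_{gh}^2-x_{gh}$; and $(1-x_{gh})\prod_{g'\ne g}(1-e_{gg'}x_{g'h})\prod_{h'\ne h}(1-e_{hh'}x_{gh'})$ for all $g,h$. $f_{\mathrm{viz}}=\sum_{g,h}x_{gh}-k_\mathcal{G}k_\mathcal{H}$. $\gamma(\cdot)$ applied to a graph is its domination number; $G\Box H$ is the Cartesian product graph. *)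

theory Defs
  imports
    Complex_Main
    "HOL-Library.Poly_Mapping"
    "HOL-Algebra.Subrings"
    "HOL-Algebra.Ideal"
    "HOL-Algebra.Algebraic_Closure_Type"
    "Graph_Theory.Pair_Digraph"
begin

section \<open>Multivariate polynomials over a subfield of the reals\<close>

text \<open>A polynomial is a finitely supported map from monomials (finitely supported exponent
  vectors) to coefficients; its ring operations are those of \<^theory>\<open>HOL-Library.Poly_Mapping\<close>.\<close>

type_synonym 'v mpoly = "('v \<Rightarrow>\<^sub>0 nat) \<Rightarrow>\<^sub>0 real"

definition Const :: "real \<Rightarrow> 'v mpoly" where
  "Const c = Poly_Mapping.single 0 c"

definition Var :: "'v \<Rightarrow> 'v mpoly" where
  "Var v = Poly_Mapping.single (Poly_Mapping.single v 1) 1"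

definition total_degree :: "'v mpoly \<Rightarrow> nat" where
  "total_degree p =
     Max (insert 0 ((\<lambda>m. \<Sum>v\<in>Poly_Mapping.keys m. Poly_Mapping.lookup m v) ` Poly_Mapping.keys p))"

definition poly_ring_over :: "real set \<Rightarrow> 'v set \<Rightarrow> 'v mpoly ring" where
  "poly_ring_over K vars = ring_of_type_algebra
     \<lparr>carrier := {p. (\<forall>m. Poly_Mapping.lookup p m \<in> K) \<and>
                     (\<forall>m\<in>Poly_Mapping.keys p. Poly_Mapping.keys m \<subseteq> vars)}\<rparr>"

definition congruent_mod :: "'v mpoly \<Rightarrow> 'v mpoly \<Rightarrow> 'v mpoly set \<Rightarrow> bool" where
  "congruent_mod p q I \<longleftrightarrow> p - q \<in> I"

text \<open>The family \<open>s\<close>, indexed by the finite set \<open>A\<close>, is a sum-of-squares certificate of degree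
  \<open>d\<close> for \<open>f\<close> modulo the ideal \<open>I\<close> of \<open>P\<close>. As usual for this notion, \<open>d\<close> bounds the degrees of
  the polynomials that are squared.\<close>

definition sos_certificate ::
  "nat \<Rightarrow> 'v mpoly ring \<Rightarrow> 'v mpoly set \<Rightarrow> 'v mpoly \<Rightarrow> 'i set \<Rightarrow> ('i \<Rightarrow> 'v mpoly) \<Rightarrow> bool" where
  "sos_certificate d P I f A s \<longleftrightarrow>
     finite A \<and> (\<forall>i\<in>A. s i \<in> carrier P \<and> total_degree (s i) \<le> d) \<and>
     congruent_mod f (\<Sum>i\<in>A. (s i)^2) I"


section \<open>The Vizing ideal\<close>

text \<open>Edge variables are indexed by 2-subsets, so that the variables of an edge \<open>gg'\<close> and of
  \<open>g'g\<close> coincide. Distinct types for the two vertex sets make these sets disjoint.\<close>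

datatype ('g, 'h) viz_var = Edge_G "'g set" | Edge_H "'h set" | Prod_Vertex 'g 'h

definition two_subsets :: "'a set \<Rightarrow> 'a set set" where
  "two_subsets A = {T. T \<subseteq> A \<and> card T = 2}"

definition viz_vars :: "'g set \<Rightarrow> 'h set \<Rightarrow> ('g, 'h) viz_var set" where
  "viz_vars VG VH = Edge_G ` two_subsets VG \<union> Edge_H ` two_subsets VH
     \<union> {Prod_Vertex g h | g h. g \<in> VG \<and> h \<in> VH}"

definition eG :: "'g \<Rightarrow> 'g \<Rightarrow> ('g, 'h) viz_var mpoly" where
  "eG g g' = Var (Edge_G {g, g'})"

definition eH :: "'h \<Rightarrow> 'h \<Rightarrow> ('g, 'h) viz_var mpoly" where
  "eH h h' = Var (Edge_H {h, h'})"

definition xv :: "'g \<Rightarrow> 'h \<Rightarrow> ('g, 'h) viz_var mpoly" where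
  "xv g h = Var (Prod_Vertex g h)"

text \<open>For one factor, with edge variables \<open>e\<close>, vertex set \<open>V\<close> and distinguished subset \<open>D\<close>:
  edges are 0/1, \<open>D\<close> is dominating, and no set of \<open>card D - 1\<close> vertices is dominating.\<close>

definition factor_generators ::
  "('a \<Rightarrow> 'a \<Rightarrow> 'v mpoly) \<Rightarrow> 'a set \<Rightarrow> 'a set \<Rightarrow> 'v mpoly set" where
  "factor_generators e V D =
     {(e v v')^2 - e v v' | v v'. v \<in> V \<and> v' \<in> V \<and> v \<noteq> v'}
     \<union> {\<Prod>v'\<in>D. (1 - e v v') | v. v \<in> V - D}
     \<union> {\<Prod>v'\<in>V - S. \<Sum>v\<in>S. e v v' | S. S \<subseteq> V \<and> card S = card D - 1}"

definition product_generators :: "'g set \<Rightarrow> 'h set \<Rightarrow> ('g, 'h) viz_var mpoly set" where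
  "product_generators VG VH =
     {(xv g h)^2 - xv g h | g h. g \<in> VG \<and> h \<in> VH}
     \<union> {(1 - xv g h) * (\<Prod>g'\<in>VG - {g}. (1 - eG g g' * xv g' h))
                     * (\<Prod>h'\<in>VH - {h}. (1 - eH h h' * xv g h')) | g h. g \<in> VG \<and> h \<in> VH}"

definition viz_ring :: "real set \<Rightarrow> 'g set \<Rightarrow> 'h set \<Rightarrow> ('g, 'h) viz_var mpoly ring" where
  "viz_ring K VG VH = poly_ring_over K (viz_vars VG VH)"

definition viz_ideal ::
  "real set \<Rightarrow> 'g set \<Rightarrow> 'g set \<Rightarrow> 'h set \<Rightarrow> 'h set \<Rightarrow> ('g, 'h) viz_var mpoly set" where
  "viz_ideal K VG DG VH DH = Idl\<^bsub>viz_ring K VG VH\<^esub>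
     (factor_generators eG VG DG \<union> factor_generators eH VH DH \<union> product_generators VG VH)"

definition viz_poly ::
  "'g set \<Rightarrow> 'g set \<Rightarrow> 'h set \<Rightarrow> 'h set \<Rightarrow> ('g, 'h) viz_var mpoly" where
  "viz_poly VG DG VH DH = (\<Sum>g\<in>VG. \<Sum>h\<in>VH. xv g h) - Const (real (card DG * card DH))"

locale vizing_setting =
  fixes K :: "real set" and VG DG :: "'g set" and VH DH :: "'h set"
  assumes subfield_K: "subfield K ring_of_type_algebra"
    and sqrt2_K: "sqrt 2 \<in> K"
    and finite_VG: "finite VG" and DG_subset: "DG \<subseteq> VG"
    and finite_VH: "finite VH" and DH_subset: "DH \<subseteq> VH"

definition cert_s0 ::
  "real \<Rightarrow> real \<Rightarrow> real \<Rightarrow> 'g set \<Rightarrow> 'h set \<Rightarrow> ('g, 'h) viz_var mpoly" where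
  "cert_s0 \<alpha> \<beta> \<gamma> VG VH = Const \<alpha> + Const \<beta> * (\<Sum>g\<in>VG. \<Sum>h\<in>VH. xv g h)
     + Const \<gamma> * (\<Sum>g\<in>VG. \<Sum>T\<in>two_subsets VH. \<Prod>h\<in>T. xv g h)"

definition cert_s :: "real \<Rightarrow> real \<Rightarrow> 'h set \<Rightarrow> 'g \<Rightarrow> ('g, 'h) viz_var mpoly" where
  "cert_s \<kappa> \<mu> VH g = Const \<kappa> * (\<Sum>h\<in>VH. xv g h)
     + Const \<mu> * (\<Sum>T\<in>two_subsets VH. \<Prod>h\<in>T. xv g h)"


section \<open>Domination number and Cartesian product\<close>

text \<open>Finite simple graphs are the symmetric loop-free digraphs of \<^locale>\<open>pair_graph\<close>.\<close>

definition dominating_set :: "'a pair_pre_digraph \<Rightarrow> 'a set \<Rightarrow> bool" where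
  "dominating_set G D \<longleftrightarrow>
     D \<subseteq> pverts G \<and> (\<forall>v\<in>pverts G - D. \<exists>u\<in>D. (u, v) \<in> parcs G)"

definition domination_number :: "'a pair_pre_digraph \<Rightarrow> nat" where
  "domination_number G = Min (card ` {D. dominating_set G D})"

definition cartesian_product ::
  "'a pair_pre_digraph \<Rightarrow> 'b pair_pre_digraph \<Rightarrow> ('a \<times> 'b) pair_pre_digraph" where
  "cartesian_product G H =
     \<lparr>pverts = pverts G \<times> pverts H,
      parcs = {((g, h), (g', h')) | g h g' h'.
                 (g = g' \<and> g \<in> pverts G \<and> (h, h') \<in> parcs H) \<or>
                 ((g, g') \<in> parcs G \<and> h = h' \<and> h \<in> pverts H)}\<rparr>"

end

theory Submission
  imports Defs
begin

text \<open>As every variable is Boolean modulo the Vizing ideal, membership in it can be tested modulo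
  the ideals in which each variable is congruent to \<open>0\<close> or \<open>1\<close>, that is, pointwise. A point at
  which all generators vanish consists of two graphs with exactly one edge each (a graph on \<open>n\<close>
  vertices has domination number \<open>n - 1\<close> iff it has a single edge) and a dominating set of their
  product. The row of the dominating set over an isolated vertex \<open>g\<close> has at least \<open>n\<^sub>H - 1\<close>
  elements, and the rows over the two ends of the edge have at least \<open>n\<^sub>H\<close> elements in total.
  Both sides of the certificate depend only on the row sizes, and \<open>n\<^sub>H \<le> 3\<close> leaves finitely
  many cases. The same two bounds yield Vizing's inequality by summation.\<close>

section \<open>Polynomials over a subfield of the reals\<close>

locale poly_over =
  fixes K :: "real set" and vars :: "'v set"
  assumes subfield_K: "subfield K ring_of_type_algebra"
begin

definition P :: "'v mpoly ring" where
  "P = poly_ring_over K vars"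

section \<open>Arithmetic in the coefficient field\<close>

lemma subfield_closed:
  "0 \<in> K" "1 \<in> K"
  "a \<in> K \<Longrightarrow> b \<in> K \<Longrightarrow> a + b \<in> K" "a \<in> K \<Longrightarrow> b \<in> K \<Longrightarrow> a * b \<in> K" "a \<in> K \<Longrightarrow> - a \<in> K"
proof -
  interpret subfield K ring_of_type_algebra by (rule subfield_K)
  interpret R: ring "ring_of_type_algebra :: real ring" by (rule ring_from_type_algebra)
  have sub: "subring K ring_of_type_algebra" by unfold_locales
  note E = subringE[OF sub]
  show "0 \<in> K" "1 \<in> K" using E(2,3) by (simp_all add: ring_of_type_algebra_def)
  show "a \<in> K \<Longrightarrow> b \<in> K \<Longrightarrow> a + b \<in> K" "a \<in> K \<Longrightarrow> b \<in> K \<Longrightarrow> a * b \<in> K"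
    using E(6)[of a b] E(7)[of a b] by (simp_all add: ring_of_type_algebra_def)
  show "- a \<in> K" if "a \<in> K"
  proof -
    have "\<ominus>\<^bsub>ring_of_type_algebra\<^esub> a = - a"
      using R.minus_equality[of "- a" a] by (simp add: ring_of_type_algebra_def)
    with E(5)[OF that] show ?thesis by simp
  qed
qed

lemma subfield_diff: "a \<in> K \<Longrightarrow> b \<in> K \<Longrightarrow> a - b \<in> K"
  using subfield_closed(3)[of a "- b"] subfield_closed(5)[of b] by simp

lemma subfield_inverse:
  assumes "a \<in> K" shows "inverse a \<in> K"
proof (cases "a = 0")
  case False
  then have "a \<in> Units (ring_of_type_algebra \<lparr>carrier := K\<rparr>)"
    using subfield.subfield_Units[OF subfield_K] assms by (simp add: ring_of_type_algebra_def)
  then obtain b where "b \<in> K" "a * b = 1"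
    by (auto simp: Units_def ring_of_type_algebra_def)
  then show ?thesis by (metis inverse_unique)
qed (simp add: subfield_closed)

lemma subfield_divide: "a \<in> K \<Longrightarrow> b \<in> K \<Longrightarrow> a / b \<in> K"
  by (simp add: divide_inverse subfield_closed subfield_inverse)

lemma subfield_sum: "(\<And>i. i \<in> A \<Longrightarrow> f i \<in> K) \<Longrightarrow> sum f A \<in> K"
  by (induction A rule: infinite_finite_induct) (auto simp: subfield_closed)

lemma subfield_of_nat: "of_nat n \<in> K"
  by (induction n) (auto simp: subfield_closed)

lemma subfield_numeral: "numeral n \<in> K"
  using subfield_of_nat[of "numeral n"] by simp

lemmas subfield_intros =
  subfield_closed subfield_diff subfield_divide subfield_of_nat subfield_numeral

section \<open>Polynomials with coefficients in \<open>K\<close> and variables in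
  \<open>vars\<close> as a subring\<close>

lemma ring_simps [simp]:
  "p \<otimes>\<^bsub>P\<^esub> q = p * q" "\<one>\<^bsub>P\<^esub> = 1" "\<zero>\<^bsub>P\<^esub> = 0" "p \<oplus>\<^bsub>P\<^esub> q = p + q"
  by (simp_all add: P_def poly_ring_over_def ring_of_type_algebra_def)

lemma carrier_iff:
  "p \<in> carrier P \<longleftrightarrow> (\<forall>m. Poly_Mapping.lookup p m \<in> K) \<and>
     (\<forall>m\<in>Poly_Mapping.keys p. Poly_Mapping.keys m \<subseteq> vars)"
  by (simp add: P_def poly_ring_over_def)

lemma carrier_add: "p \<in> carrier P \<Longrightarrow> q \<in> carrier P \<Longrightarrow> p + q \<in> carrier P"
  using keys_add[of p q] by (fastforce simp: carrier_iff lookup_add subfield_closed)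

lemma carrier_uminus: "p \<in> carrier P \<Longrightarrow> - p \<in> carrier P"
  by (auto simp: carrier_iff subfield_closed in_keys_iff)

lemma carrier_diff: "p \<in> carrier P \<Longrightarrow> q \<in> carrier P \<Longrightarrow> p - q \<in> carrier P"
  using carrier_add[of p "- q"] carrier_uminus[of q] by simp

lemma carrier_mult:
  assumes "p \<in> carrier P" "q \<in> carrier P"
  shows "p * q \<in> carrier P"
proof -
  have "Poly_Mapping.lookup (p * q) m \<in> K" for m
    using assms unfolding lookup_mult Sum_any.expand_set carrier_iff
    by (intro subfield_sum subfield_closed) (auto simp: when_def subfield_closed)
  moreover have "Poly_Mapping.keys m \<subseteq> vars" if m: "m \<in> Poly_Mapping.keys (p * q)" for m
  proof -
    obtain a b where "a \<in> Poly_Mapping.keys p" "b \<in> Poly_Mapping.keys q" "m = a + b"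
      using m keys_mult[of p q] by blast
    with assms keys_add[of a b] show ?thesis unfolding carrier_iff by blast
  qed
  ultimately show ?thesis by (simp add: carrier_iff)
qed

lemma carrier_Const: "c \<in> K \<Longrightarrow> Const c \<in> carrier P"
  by (auto simp: carrier_iff Const_def lookup_single when_def subfield_closed)

lemma Const_0 [simp]: "Const 0 = 0" and Const_1 [simp]: "Const 1 = 1"
  by (simp_all add: Const_def)

lemma Const_add: "Const (a + b) = Const a + Const b"
  and Const_diff: "Const (a - b) = Const a - Const b"
  and Const_mult: "Const (a * b) = Const a * Const b"
  by (simp_all add: Const_def single_add single_diff mult_single)

lemma carrier_0: "0 \<in> carrier P" and carrier_1: "1 \<in> carrier P"
  using carrier_Const[of 0] carrier_Const[of 1] by (simp_all add: subfield_closed)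

lemma carrier_Var: "v \<in> vars \<Longrightarrow> Var v \<in> carrier P"
  by (auto simp: carrier_iff Var_def lookup_single when_def subfield_closed)

lemma carrier_sum: "(\<And>i. i \<in> A \<Longrightarrow> f i \<in> carrier P) \<Longrightarrow> sum f A \<in> carrier P"
  by (induction A rule: infinite_finite_induct) (auto simp: carrier_0 carrier_add)

lemma carrier_prod: "(\<And>i. i \<in> A \<Longrightarrow> f i \<in> carrier P) \<Longrightarrow> prod f A \<in> carrier P"
  by (induction A rule: infinite_finite_induct) (auto simp: carrier_1 carrier_mult)

lemma ring_P: "ring P"
proof -
  interpret R: ring "ring_of_type_algebra :: 'v mpoly ring" by (rule ring_from_type_algebra)
  \<comment> \<open>The ring axioms are inherited from the ring of all real polynomials once the
    carrier is known to be a subring.\<close>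
  have "subring (carrier P) (ring_of_type_algebra :: 'v mpoly ring)"
  proof (rule R.subringI)
    fix p :: "'v mpoly" assume p: "p \<in> carrier P"
    have "\<ominus>\<^bsub>ring_of_type_algebra\<^esub> p = - p"
      using R.minus_equality[of "- p" p] by (simp add: ring_of_type_algebra_def)
    then show "\<ominus>\<^bsub>ring_of_type_algebra\<^esub> p \<in> carrier P" using carrier_uminus[OF p] by simp
  qed (simp_all add: ring_of_type_algebra_def carrier_1 carrier_mult carrier_add)
  from R.subring_is_ring[OF this] show ?thesis
    by (simp add: P_def poly_ring_over_def)
qed

lemma uminus_P: "p \<in> carrier P \<Longrightarrow> \<ominus>\<^bsub>P\<^esub> p = - p"
proof -
  interpret ring P by (rule ring_P)
  show "p \<in> carrier P \<Longrightarrow> \<ominus>\<^bsub>P\<^esub> p = - p"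
    using minus_equality[of "- p" p] carrier_uminus[of p] by simp
qed

text \<open>Negation is multiplication by \<open>- 1\<close>, and commutativity turns left
  absorption into right absorption, so these few closure conditions suffice. They allow ideals to be
  handled with the type-class operations.\<close>

lemma ideal_iff:
  "ideal J P \<longleftrightarrow> J \<subseteq> carrier P \<and> 0 \<in> J \<and> (\<forall>p\<in>J. \<forall>q\<in>J. p + q \<in> J) \<and>
     (\<forall>p\<in>J. \<forall>q\<in>carrier P. q * p \<in> J)" (is "?L \<longleftrightarrow> ?R")
proof
  assume ?L
  then interpret ideal J P .
  show ?R
    using a_subset additive_subgroup.zero_closed[OF additive_subgroup_axioms]
      additive_subgroup.a_closed[OF additive_subgroup_axioms] I_l_closed by auto
next
  assume R: ?R
  interpret ring P by (rule ring_P)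
  have um: "- p \<in> J" if "p \<in> J" for p
  proof -
    have "- 1 * p \<in> J" using R that carrier_uminus[OF carrier_1] by blast
    then show ?thesis by simp
  qed
  show ?L
  proof (rule idealI)
    show "subgroup J (add_monoid P)"
    proof (rule add.subgroupI)
      fix p assume "p \<in> J"
      with R have "\<ominus>\<^bsub>P\<^esub> p = - p" by (intro uminus_P) auto
      with um[OF \<open>p \<in> J\<close>] show "\<ominus>\<^bsub>P\<^esub> p \<in> J" by simp
    qed (use R in auto)
  qed (use R ring_P in \<open>auto simp: mult.commute\<close>)
qed

text \<open>This is the colon ideal \<open>(I : q)\<close>. It enlarges \<open>I\<close> by every
  \<open>p\<close> with \<open>p * q \<in> I\<close>, which is how a Boolean variable gets its value
  fixed below.\<close>

lemma ideal_colon: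
  assumes "ideal I P" "q \<in> carrier P"
  shows "ideal {p \<in> carrier P. p * q \<in> I} P"
  using assms unfolding ideal_iff
  by (auto simp: carrier_0 carrier_add carrier_mult distrib_right mult.assoc)

text \<open>Radicality of Boolean ideals without a Nullstellensatz: \<open>I\<close> is the intersection of
  \<open>(I : v)\<close> and \<open>(I : 1 - v)\<close>, and modulo these the variable \<open>v\<close> is \<open>1\<close> and \<open>0\<close>,
  respectively.\<close>
lemma Boolean_ideal_membership:
  assumes "finite W" "W \<subseteq> vars" "ideal I P" "f \<in> carrier P"
    and "\<And>v. v \<in> W \<Longrightarrow> (Var v)^2 - Var v \<in> I"
    and "\<And>J. ideal J P \<Longrightarrow> I \<subseteq> J \<Longrightarrow> (\<And>v. v \<in> W \<Longrightarrow> Var v \<in> J \<or> 1 - Var v \<in> J) \<Longrightarrow> f \<in> J"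
  shows "f \<in> I"
  using assms
proof (induction W arbitrary: I rule: finite_induct)
  case (insert v W)
  note I = insert.prems(2)[unfolded ideal_iff]
  have v: "Var v \<in> carrier P" "1 - Var v \<in> carrier P"
    using insert.prems(1) by (auto intro: carrier_Var carrier_diff carrier_1)
  \<comment> \<open>The induction hypothesis is applied to \<open>(I : q)\<close>, which already
    contains \<open>v\<close> or \<open>1 - v\<close>. Every ideal above it that decides the
    variables in \<open>W\<close> therefore decides \<open>v\<close> as well, so it contains
    \<open>f\<close>.\<close>
  have f_colon: "f * q \<in> I" if q: "q \<in> carrier P"
    and v': "Var v * q \<in> I \<or> (1 - Var v) * q \<in> I" for q
  proof -
    define J where "J = {p \<in> carrier P. p * q \<in> I}"
    have J: "ideal J P" unfolding J_def by (rule ideal_colon) (use insert.prems q in auto)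
    have IJ: "I \<subseteq> J" unfolding J_def using I q by (auto simp: mult.commute)
    have vJ: "Var v \<in> J \<or> 1 - Var v \<in> J" unfolding J_def using v v' by auto
    have "f \<in> J"
    proof (rule insert.IH)
      fix J' assume "ideal J' P" "J \<subseteq> J'" "\<And>w. w \<in> W \<Longrightarrow> Var w \<in> J' \<or> 1 - Var w \<in> J'"
      then show "f \<in> J'" using insert.prems(5)[of J'] IJ vJ by auto
    qed (use insert.prems J IJ in auto)
    then show ?thesis by (simp add: J_def)
  qed
  have vv: "(Var v)^2 - Var v \<in> I" using insert.prems(4) by simp
  \<comment> \<open>Since \<open>v * (1 - v)\<close> lies in \<open>I\<close>, both
    \<open>q = v\<close> and \<open>q = 1 - v\<close> are admissible in \<open>f_colon\<close>;
    finally \<open>f = f * v + f * (1 - v)\<close>.\<close>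
  have "- 1 * ((Var v)^2 - Var v) \<in> I" using I vv carrier_uminus[OF carrier_1] by blast
  then have "(1 - Var v) * Var v \<in> I" by (simp add: algebra_simps power2_eq_square)
  then have "f * Var v \<in> I" "f * (1 - Var v) \<in> I"
    using f_colon[OF v(1)] f_colon[OF v(2)] by (auto simp: mult.commute)
  then have "f * Var v + f * (1 - Var v) \<in> I" using I by blast
  then show ?case by (simp add: algebra_simps)
qed auto

end

section \<open>Evaluation of polynomials modulo an ideal\<close>

locale poly_over_ideal = poly_over K vars for K :: "real set" and vars :: "'v set" +
  fixes J :: "'v mpoly set"
  assumes ideal_J: "ideal J P"
begin

text \<open>The ideal \<open>J\<close> plays the role of a point and \<open>c\<close> that of the
  value of \<open>p\<close> there. A relation is used because not every polynomial need be congruent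
  to a constant, and the constant is unique only if \<open>J\<close> is proper.\<close>

definition evaluates :: "'v mpoly \<Rightarrow> real \<Rightarrow> bool" where
  "evaluates p c \<longleftrightarrow> p \<in> carrier P \<and> c \<in> K \<and> p - Const c \<in> J"

lemma J_add: "p \<in> J \<Longrightarrow> q \<in> J \<Longrightarrow> p + q \<in> J"
  and J_mult: "p \<in> J \<Longrightarrow> q \<in> carrier P \<Longrightarrow> q * p \<in> J"
  and J_0: "0 \<in> J"
  using ideal_J unfolding ideal_iff by auto

lemma J_uminus: "p \<in> J \<Longrightarrow> - p \<in> J"
  using J_mult[of p "- 1"] carrier_uminus[OF carrier_1] by simp

lemma J_diff: "p \<in> J \<Longrightarrow> q \<in> J \<Longrightarrow> p - q \<in> J"
  using J_add[of p "- q"] J_uminus[of q] by simp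

lemma evaluates_Const: "c \<in> K \<Longrightarrow> evaluates (Const c) c"
  by (simp add: evaluates_def carrier_Const J_0)

lemma evaluates_0: "evaluates 0 0" and evaluates_1: "evaluates 1 1"
  using evaluates_Const[of 0] evaluates_Const[of 1] by (simp_all add: subfield_closed)

lemma evaluates_add:
  assumes "evaluates p c" "evaluates q d" shows "evaluates (p + q) (c + d)"
  using assms J_add[of "p - Const c" "q - Const d"]
  by (auto simp: evaluates_def carrier_add subfield_closed Const_add algebra_simps)

lemma evaluates_diff:
  assumes "evaluates p c" "evaluates q d" shows "evaluates (p - q) (c - d)"
  using assms J_diff[of "p - Const c" "q - Const d"]
  by (auto simp: evaluates_def carrier_diff subfield_diff Const_diff algebra_simps)

lemma evaluates_mult:
  assumes "evaluates p c" "evaluates q d" shows "evaluates (p * q) (c * d)"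
proof -
  have "q * (p - Const c) + Const c * (q - Const d) \<in> J"
    using assms by (intro J_add J_mult) (auto simp: evaluates_def carrier_Const)
  then show ?thesis
    using assms by (simp add: evaluates_def carrier_mult subfield_closed Const_mult algebra_simps)
qed

lemma evaluates_power2: "evaluates p c \<Longrightarrow> evaluates (p^2) (c^2)"
  by (simp add: power2_eq_square evaluates_mult)

lemma evaluates_sum:
  "(\<And>i. i \<in> A \<Longrightarrow> evaluates (f i) (g i)) \<Longrightarrow> evaluates (sum f A) (sum g A)"
  by (induction A rule: infinite_finite_induct) (auto intro: evaluates_0 evaluates_add)

lemma evaluates_prod:
  "(\<And>i. i \<in> A \<Longrightarrow> evaluates (f i) (g i)) \<Longrightarrow> evaluates (prod f A) (prod g A)"
  by (induction A rule: infinite_finite_induct) (auto intro: evaluates_1 evaluates_mult)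

lemmas evaluates_intros = evaluates_Const evaluates_0 evaluates_1 evaluates_add evaluates_diff
  evaluates_mult evaluates_power2 evaluates_sum evaluates_prod

text \<open>If \<open>1 - Var v\<close> is not in \<open>J\<close>, then \<open>Var v\<close> is, so
  the truth value of this membership is the 0/1 value of the variable.\<close>

lemma evaluates_Var:
  assumes "v \<in> vars" "Var v \<in> J \<or> 1 - Var v \<in> J"
  shows "evaluates (Var v) (of_bool (1 - Var v \<in> J))"
  using assms J_uminus[of "1 - Var v"]
  by (auto simp: evaluates_def carrier_Var subfield_closed)

text \<open>A nonzero constant in \<open>J\<close> would be a unit of the ring and force
  \<open>1 \<in> J\<close>. Hence generators, which lie in \<open>J\<close>, have value zero at the
  point.\<close>

lemma evaluates_in_J:
  assumes "evaluates p c" "p \<in> J" "1 \<notin> J" shows "c = 0"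
proof (rule ccontr)
  assume "c \<noteq> 0"
  have "Const c \<in> J"
    using assms J_diff[of p "p - Const c"] by (simp add: evaluates_def)
  then have "Const (inverse c) * Const c \<in> J"
    using assms by (intro J_mult carrier_Const subfield_inverse) (auto simp: evaluates_def)
  with \<open>c \<noteq> 0\<close> \<open>1 \<notin> J\<close> show False by (simp flip: Const_mult)
qed

lemma evaluates_zero_in_J: "evaluates p 0 \<Longrightarrow> p \<in> J"
  by (simp add: evaluates_def)

lemma one_in_J: "1 \<in> J \<Longrightarrow> p \<in> carrier P \<Longrightarrow> p \<in> J"
  using J_mult[of 1 p] by simp

end

section \<open>Graphs with a single edge\<close>

text \<open>The one vertex \<open>a\<close> outside \<open>D\<close> has a neighbour
  \<open>b\<close> in \<open>D\<close>. A second edge would allow two vertices to be removed from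
  \<open>V\<close> so that the rest still dominates, but the rest has only \<open>card D - 1\<close>
  elements.\<close>

lemma unique_edge:
  assumes "finite V" "D \<subseteq> V" "card V = Suc (card D)"
    and sym: "\<And>u v. E u v \<Longrightarrow> E v u"
    and dom: "\<And>v. v \<in> V - D \<Longrightarrow> \<exists>u\<in>D. E v u"
    and nodom: "\<And>S. S \<subseteq> V \<Longrightarrow> card S = card D - 1 \<Longrightarrow> \<exists>v\<in>V - S. \<forall>u\<in>S. \<not> E u v"
  obtains a b where "a \<in> V" "b \<in> V" "a \<noteq> b"
    and "\<forall>u\<in>V. \<forall>v\<in>V. u \<noteq> v \<longrightarrow> (E u v \<longleftrightarrow> {u, v} = {a, b})"
proof -
  have "card (V - D) = 1"
    using assms(1-3) by (simp add: card_Diff_subset finite_subset)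
  then obtain a where a: "V - D = {a}" by (auto simp: card_1_singleton_iff)
  then obtain b where b: "b \<in> D" "E a b" using dom by blast
  have ab: "a \<in> V" "b \<in> V" "a \<noteq> b" using a b assms(2) by auto
  \<comment> \<open>If \<open>p\<close> and \<open>q\<close> both have neighbours outside
    \<open>{p, q}\<close>, then the complement of \<open>{p, q}\<close> is a dominating set with
    \<open>card V - 2 = card D - 1\<close> elements.\<close>
  have two: False if "p \<in> V" "q \<in> V" "p \<noteq> q" "r \<in> V - {p, q}" "s \<in> V - {p, q}" "E r p" "E s q" for p q r s
  proof -
    have "card (V - {p, q}) = card D - 1"
      using that assms(1,3) by (simp add: card_Diff_subset)
    then obtain v where "v \<in> V - (V - {p, q})" "\<forall>u\<in>V - {p, q}. \<not> E u v"
      using nodom[of "V - {p, q}"] by auto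
    with that show False by auto
  qed
  have "{u, v} = {a, b}" if uv: "u \<in> V" "v \<in> V" "u \<noteq> v" "E u v" for u v
  proof (rule ccontr)
    assume "{u, v} \<noteq> {a, b}"
    then have "\<not> (u = a \<and> v = b)" "\<not> (u = b \<and> v = a)" by auto
    \<comment> \<open>If the second edge meets \<open>{a, b}\<close> in one vertex, the far ends of
      the two edges are removed, both being dominated by the common vertex. If the edges are
      disjoint, one end of each is removed.\<close>
    then consider "u = a" "v \<noteq> b" | "u = b" "v \<noteq> a" | "v = a" "u \<noteq> b" | "v = b" "u \<noteq> a"
      | "u \<notin> {a, b}" "v \<notin> {a, b}" using uv(3) by auto
    then show False
    proof cases
      case 1 then show False using two[of v b a a] uv ab b sym by auto
    next
      case 2 then show False using two[of v a b b] uv ab b sym by auto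
    next
      case 3 then show False using two[of u b a a] uv ab b sym by auto
    next
      case 4 then show False using two[of u a b b] uv ab b sym by auto
    next
      case 5 then show False using two[of a u b v] uv ab b sym by auto
    qed
  qed
  moreover have "E u v" if "{u, v} = {a, b}" for u v
    using that b(2) sym by (auto simp: doubleton_eq_iff)
  ultimately show thesis using that[OF ab] by metis
qed

text \<open>Here \<open>Y\<close> is a dominating set in the product of two graphs whose only edges
  are \<open>ab\<close> and \<open>cd\<close>. Stated with a predicate, the setting serves both for
  the points of the Vizing ideal and for actual product graphs.\<close>

locale one_edge_dominated =
  fixes VG :: "'g set" and VH :: "'h set" and a b :: 'g and c d :: 'h and Y :: "'g \<Rightarrow> 'h \<Rightarrow> bool"
  assumes finite: "finite VG" "finite VH"
    and edge_G: "a \<in> VG" "b \<in> VG" "a \<noteq> b" and edge_H: "c \<in> VH" "d \<in> VH" "c \<noteq> d"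
    and dominated: "\<And>g h. g \<in> VG \<Longrightarrow> h \<in> VH \<Longrightarrow> Y g h
      \<or> g = a \<and> Y b h \<or> g = b \<and> Y a h \<or> h = c \<and> Y g d \<or> h = d \<and> Y g c"
begin

definition row :: "'g \<Rightarrow> 'h set" where
  "row g = {h \<in> VH. Y g h}"

lemma finite_row: "finite (row g)"
  using finite by (simp add: row_def)

lemma card_row_le: "card (row g) \<le> card VH"
  using finite by (auto simp: row_def intro: card_mono)

text \<open>No help comes from other rows, so the row alone dominates a graph with the single edge
  \<open>cd\<close>: it can miss only one of \<open>c\<close> and \<open>d\<close> and nothing
  else.\<close>

lemma card_row_isolated:
  assumes "g \<in> VG - {a, b}"
  shows "card VH - 1 \<le> card (row g)"
proof -
  have "Y g h \<or> h = c \<and> Y g d \<or> h = d \<and> Y g c" if "h \<in> VH" for h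
    using dominated[of g h] assms that by auto
  then have "VH - {c} \<subseteq> row g \<or> VH - {d} \<subseteq> row g"
    unfolding row_def using edge_H by auto
  then have "card (VH - {c}) \<le> card (row g) \<or> card (VH - {d}) \<le> card (row g)"
    using finite_row card_mono by blast
  then show ?thesis using finite edge_H by simp
qed

text \<open>Either the two rows together cover \<open>VH\<close>, or they miss one end of
  \<open>cd\<close>. In the latter case the other end lies in both rows, and this double count makes
  up for the missing vertex.\<close>

lemma card_rows_edge: "card VH \<le> card (row a) + card (row b)"
proof (cases "VH \<subseteq> row a \<union> row b")
  case True
  then have "card VH \<le> card (row a \<union> row b)" by (simp add: card_mono finite_row)
  then show ?thesis using card_Un_le[of "row a" "row b"] by linarith
next
  case False
  \<comment> \<open>If neither row contains \<open>h\<close>, both \<open>(a, h)\<close> and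
    \<open>(b, h)\<close> must be dominated along the edge \<open>cd\<close>, which puts its other
    end into both rows.\<close>
  have dom: "Y a h \<or> Y b h \<or> h = c \<and> Y a d \<and> Y b d \<or> h = d \<and> Y a c \<and> Y b c"
    if "h \<in> VH" for h
    using dominated[of a h] dominated[of b h] edge_G that by metis
  obtain h where "h \<in> VH" "\<not> Y a h" "\<not> Y b h" using False by (auto simp: row_def)
  with dom[of h] edge_H obtain h' where h: "h \<in> VH" "h' \<in> VH" "h \<in> {c, d}" "h' \<in> {c, d}" "h \<noteq> h'"
    "Y a h'" "Y b h'" by blast
  have "VH - {h} \<subseteq> row a \<union> row b"
  proof
    fix k assume k: "k \<in> VH - {h}"
    show "k \<in> row a \<union> row b"
    proof (cases "k = h'")
      case False
      then have "k \<noteq> c" "k \<noteq> d" using h k by auto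
      then show ?thesis using dom[of k] k by (simp add: row_def)
    qed (use h in \<open>simp add: row_def\<close>)
  qed
  then have "card (VH - {h}) \<le> card (row a \<union> row b)" by (simp add: card_mono finite_row)
  moreover have "h' \<in> row a \<inter> row b" using h by (simp add: row_def)
  then have "card {h'} \<le> card (row a \<inter> row b)"
    by (intro card_mono) (auto simp: finite_row)
  moreover have "card VH = Suc (card (VH - {h}))" using finite h(1) by (metis card_Suc_Diff1)
  ultimately show ?thesis using card_Un_Int[OF finite_row[of a] finite_row[of b]] by simp
qed

section \<open>Summation over the rows: the size bound and the certificate identity\<close>

lemma sum_edge_G: "sum f VG = sum f (VG - {a, b}) + f a + f b" for f :: "'g \<Rightarrow> 'c::ab_group_add"
proof -
  have "VG = insert a (insert b (VG - {a, b}))" using edge_G by auto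
  then have "sum f VG = sum f (insert a (insert b (VG - {a, b})))" by simp
  also have "\<dots> = sum f (VG - {a, b}) + f a + f b"
    using finite edge_G by (simp add: algebra_simps)
  finally show ?thesis .
qed

lemma card_VG: "card VG = card (VG - {a, b}) + 2"
proof -
  have "card {a, b} \<le> card VG" using finite edge_G by (intro card_mono) auto
  then show ?thesis using finite edge_G by (simp add: card_Diff_subset)
qed

text \<open>With \<open>m = card VG - 2\<close> isolated vertices and \<open>n = card VH\<close>,
  the row bounds add up to \<open>m * (n - 1) + n\<close>, one more than
  \<open>(m + 1) * (n - 1)\<close>.\<close>

lemma card_rows_ge: "(card VG - 1) * (card VH - 1) \<le> (\<Sum>g\<in>VG. card (row g))"
proof -
  have "(card VG - 1) * (card VH - 1) \<le> card (VG - {a, b}) * (card VH - 1) + card VH"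
    by (simp add: card_VG)
  also have "card (VG - {a, b}) * (card VH - 1) \<le> (\<Sum>g\<in>VG - {a, b}. card (row g))"
    using sum_mono[of "VG - {a, b}" "\<lambda>_. card VH - 1" "\<lambda>g. card (row g)"] card_row_isolated by simp
  also note card_rows_edge
  also have "(\<Sum>g\<in>VG - {a, b}. card (row g)) + (card (row a) + card (row b)) = (\<Sum>g\<in>VG. card (row g))"
    \<comment> \<open>The splitting of the sum is stated for groups, hence the passage through the
      integers.\<close>
    using sum_edge_G[of "\<lambda>g. int (card (row g))"] by (simp flip: of_nat_sum of_nat_add)
  finally show ?thesis by simp
qed

text \<open>This is the certificate evaluated at a point, where linear sums become row sizes and
  sums over pairs become binomial coefficients. The isolated rows cancel from both sides, which
  leaves an identity in the two row sizes over \<open>a\<close> and \<open>b\<close>.\<close>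

lemma certificate_rows:
  fixes \<alpha> \<beta> \<gamma> \<kappa> \<mu> :: real
  assumes "card VH \<in> {2, 3}"
    and "card VH = 2 \<Longrightarrow> \<alpha> = real (card VG) - 1 \<and> \<beta> = -1 \<and> \<gamma> = 1 \<and> \<kappa> = 0 \<and> \<mu> = 1"
    and "card VH = 3 \<Longrightarrow> \<alpha> = sqrt 2 * (real (card VG) - 1) \<and> \<beta> = - (2/3) * sqrt 2
      \<and> \<gamma> = 1/3 * sqrt 2 \<and> \<kappa> = 1/3 \<and> \<mu> = - (2/3)"
  defines "r \<equiv> \<lambda>g. real (card (row g))" and "r2 \<equiv> \<lambda>g. real (card (row g) choose 2)"
  shows "(\<Sum>g\<in>VG. r g) - real ((card VG - 1) * (card VH - 1)) =
    (\<alpha> + \<beta> * (\<Sum>g\<in>VG. r g) + \<gamma> * (\<Sum>g\<in>VG. r2 g))^2 + (\<Sum>g\<in>VG. (\<kappa> * r g + \<mu> * r2 g)^2)"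
proof -
  define W where "W = VG - {a, b}"
  define m where "m = real (card (VG - {a, b}))"
  \<comment> \<open>\<open>- t\<close> is the common value of
    \<open>\<beta> * r + \<gamma> * r2\<close> at the only two sizes of an isolated row,
    \<open>card VH - 1\<close> and \<open>card VH\<close>; \<open>k\<close> below is the smaller of
    these sizes.\<close>
  define t :: real where "t = (if card VH = 2 then 1 else sqrt 2)"
  define k where "k = real (card VH) - 1"
  have \<alpha>: "\<alpha> = t * (m + 1)"
    using assms(1-3) card_VG by (auto simp: m_def t_def)
  \<comment> \<open>The coefficients are fitted to the two possible sizes: the contribution to
    \<open>s0\<close> is constant, and the square is 0 for the smaller size and 1 for the
    larger.\<close>
  have row_W: "\<beta> * r g + \<gamma> * r2 g = - t \<and> (\<kappa> * r g + \<mu> * r2 g)^2 = r g - k" if "g \<in> W" for g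
  proof -
    have "card (row g) = card VH - 1 \<or> card (row g) = card VH"
      using card_row_isolated[of g] card_row_le[of g] that by (auto simp: W_def)
    then show ?thesis
      using assms(1-3) by (auto simp: r_def r2_def t_def k_def choose_two power2_eq_square)
  qed
  have "(\<Sum>g\<in>W. \<beta> * r g + \<gamma> * r2 g) = (\<Sum>g\<in>W. - t)"
    by (rule sum.cong) (use row_W in auto)
  then have s0: "\<beta> * (\<Sum>g\<in>W. r g) + \<gamma> * (\<Sum>g\<in>W. r2 g) = - t * m"
    by (simp add: sum.distrib m_def W_def flip: sum_distrib_left)
  have "(\<Sum>g\<in>W. (\<kappa> * r g + \<mu> * r2 g)^2) = (\<Sum>g\<in>W. r g - k)"
    by (rule sum.cong) (use row_W in auto)
  then have s: "(\<Sum>g\<in>W. (\<kappa> * r g + \<mu> * r2 g)^2) = (\<Sum>g\<in>W. r g) - m * k"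
    by (simp add: sum_subtractf m_def W_def)
  \<comment> \<open>What is left after the cancellation: a check over all pairs of row sizes at most
    \<open>card VH\<close> with sum at least \<open>card VH\<close>.\<close>
  have edge: "r a + r b - k = (t + \<beta> * (r a + r b) + \<gamma> * (r2 a + r2 b))^2
    + (\<kappa> * r a + \<mu> * r2 a)^2 + (\<kappa> * r b + \<mu> * r2 b)^2"
  proof -
    have le: "card VH \<le> card (row a) + card (row b)" "card (row a) \<le> card VH" "card (row b) \<le> card VH"
      using card_rows_edge card_row_le by auto
    consider "card VH = 2" | "card VH = 3" using assms(1) by auto
    then show ?thesis
    proof cases
      case 1
      then have "card (row a) \<in> {0, 1, 2}" "card (row b) \<in> {0, 1, 2}"
        using le by auto
      moreover have "\<beta> = -1" "\<gamma> = 1" "\<kappa> = 0" "\<mu> = 1" "t = 1"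
        using assms(2)[OF 1] 1 by (simp_all add: t_def)
      ultimately show ?thesis
        using le unfolding r_def r2_def k_def 1
        by (elim insertE emptyE) (simp_all add: choose_two)
    next
      case 2
      \<comment> \<open>Factoring out \<open>sqrt 2\<close> makes the square rational, so that the
        case check is plain arithmetic.\<close>
      have "t + \<beta> * (r a + r b) + \<gamma> * (r2 a + r2 b)
          = sqrt 2 * (1 - 2/3 * (r a + r b) + 1/3 * (r2 a + r2 b))"
      proof -
        have "x + (- (2/3) * x) * y + (1/3 * x) * z = x * (1 - 2/3 * y + 1/3 * z)" for x y z :: real
          by (simp add: algebra_simps)
        moreover have "t = sqrt 2" using 2 by (simp add: t_def)
        moreover have "\<beta> = - (2/3) * sqrt 2" "\<gamma> = 1/3 * sqrt 2"
          using assms(3)[OF 2] by blast+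
        ultimately show ?thesis by (simp only:)
      qed
      then have s0: "(t + \<beta> * (r a + r b) + \<gamma> * (r2 a + r2 b))^2
          = 2 * (1 - 2/3 * (r a + r b) + 1/3 * (r2 a + r2 b))^2"
        by (simp only: power_mult_distrib) simp
      have "card (row a) \<in> {0, 1, 2, 3}" "card (row b) \<in> {0, 1, 2, 3}"
        using le 2 by auto
      moreover have \<kappa>\<mu>: "\<kappa> = 1/3" "\<mu> = - (2/3)" using assms(3)[OF 2] by blast+
      ultimately show ?thesis
        using le unfolding s0 unfolding \<kappa>\<mu> r_def r2_def k_def 2
        by (elim insertE emptyE) (simp_all add: choose_two power2_eq_square)
    qed
  qed
  \<comment> \<open>As \<open>\<alpha> = t * (m + 1)\<close>, the \<open>m\<close> isolated rows,
    each contributing \<open>- t\<close>, reduce the constant term to \<open>t\<close>.\<close>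
  have s0_VG: "\<alpha> + \<beta> * (\<Sum>g\<in>VG. r g) + \<gamma> * (\<Sum>g\<in>VG. r2 g)
      = t + \<beta> * (r a + r b) + \<gamma> * (r2 a + r2 b)"
    unfolding sum_edge_G[of r] sum_edge_G[of r2] \<alpha> using s0 by (simp add: W_def algebra_simps)
  have k: "real ((card VG - 1) * (card VH - 1)) = m * k + k"
    using assms(1) card_VG by (auto simp: m_def k_def)
  show ?thesis
    unfolding s0_VG k
    unfolding sum_edge_G[of r] sum_edge_G[of "\<lambda>g. (\<kappa> * r g + \<mu> * r2 g)^2"]
    using edge s[unfolded W_def] by linarith
qed

end

section \<open>The certificate\<close>

text \<open>The generators have value zero at the point, and a vanishing product has a vanishing
  factor. A zero factor \<open>1 - e\<close> is an adjacency; a zero sum of 0/1 values means that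
  all its terms are zero.\<close>

lemma (in poly_over_ideal) factor_semantics:
  assumes "finite V" "D \<subseteq> V" "1 \<notin> J" "factor_generators e V D \<subseteq> J"
    and e: "\<And>u v. u \<in> V \<Longrightarrow> v \<in> V \<Longrightarrow> u \<noteq> v \<Longrightarrow> evaluates (e u v) (of_bool (E u v))"
  shows "v \<in> V - D \<Longrightarrow> \<exists>u\<in>D. E v u"
    and "S \<subseteq> V \<Longrightarrow> card S = card D - 1 \<Longrightarrow> \<exists>v\<in>V - S. \<forall>u\<in>S. \<not> E u v"
proof -
  show "\<exists>u\<in>D. E v u" if v: "v \<in> V - D"
  proof -
    have "evaluates (\<Prod>u\<in>D. 1 - e v u) (\<Prod>u\<in>D. 1 - of_bool (E v u))"
      using v assms(2) by (intro evaluates_intros e) auto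
    moreover have "(\<Prod>u\<in>D. 1 - e v u) \<in> J"
      using assms(4) v unfolding factor_generators_def by blast
    ultimately have "(\<Prod>u\<in>D. 1 - of_bool (E v u)) = (0::real)"
      using evaluates_in_J assms(3) by blast
    then show ?thesis
      using assms(1,2) by (auto simp: finite_subset)
  qed
  show "\<exists>v\<in>V - S. \<forall>u\<in>S. \<not> E u v" if S: "S \<subseteq> V" "card S = card D - 1"
  proof -
    have fin: "finite S" "finite (V - S)" using S assms(1) by (auto simp: finite_subset)
    have "evaluates (\<Prod>v\<in>V - S. \<Sum>u\<in>S. e u v) (\<Prod>v\<in>V - S. \<Sum>u\<in>S. of_bool (E u v))"
      using S by (intro evaluates_intros e) auto
    moreover have "(\<Prod>v\<in>V - S. \<Sum>u\<in>S. e u v) \<in> J"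
      using assms(4) S unfolding factor_generators_def by blast
    ultimately have "(\<Prod>v\<in>V - S. \<Sum>u\<in>S. of_bool (E u v)) = (0::real)"
      using evaluates_in_J assms(3) by blast
    then obtain v where "v \<in> V - S" "(\<Sum>u\<in>S. of_bool (E u v)) = (0::real)"
      using fin by (auto simp del: sum_of_bool_eq)
    then show ?thesis
      using fin by (subst (asm) sum_nonneg_eq_0_iff) auto
  qed
qed

lemma finite_two_subsets: "finite A \<Longrightarrow> finite (two_subsets A)"
  by (simp add: two_subsets_def)

text \<open>Each product is the indicator of \<open>T\<close> lying inside the set where
  \<open>Q\<close> holds, so the sum counts the 2-subsets of that set.\<close>

lemma sum_two_subsets_of_bool:
  assumes "finite A"
  shows "(\<Sum>T\<in>two_subsets A. \<Prod>x\<in>T. of_bool (Q x)) = real (card {x \<in> A. Q x} choose 2)"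
proof -
  have "(\<Prod>x\<in>T. of_bool (Q x)) = (of_bool (\<forall>x\<in>T. Q x) :: real)" if "T \<in> two_subsets A" for T
  proof -
    have "finite T" using that assms by (auto simp: two_subsets_def finite_subset)
    then show ?thesis by (induction T) auto
  qed
  then have "(\<Sum>T\<in>two_subsets A. \<Prod>x\<in>T. of_bool (Q x))
      = (\<Sum>T\<in>two_subsets A. of_bool (\<forall>x\<in>T. Q x) :: real)"
    by (rule sum.cong[OF refl])
  also have "\<dots> = real (card {T \<in> two_subsets A. \<forall>x\<in>T. Q x})"
    by (simp add: finite_two_subsets assms Int_def)
  also have "{T \<in> two_subsets A. \<forall>x\<in>T. Q x} = {T. T \<subseteq> {x \<in> A. Q x} \<and> card T = 2}"
    by (auto simp: two_subsets_def)
  finally show ?thesis using assms by (simp add: n_subsets)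
qed

section \<open>Membership of the certificate identity in the Vizing ideal\<close>

context vizing_setting
begin

lemma finite_viz_vars: "finite (viz_vars VG VH)"
proof -
  have "{Prod_Vertex g h | g h. g \<in> VG \<and> h \<in> VH} = (\<lambda>(g, h). Prod_Vertex g h) ` (VG \<times> VH)"
    by auto
  then show ?thesis
    using finite_VG finite_VH by (simp add: viz_vars_def finite_two_subsets)
qed

sublocale poly_over K "viz_vars VG VH"
  by (rule poly_over.intro, rule subfield_K)

lemma P_eq_viz_ring: "P = viz_ring K VG VH"
  by (simp add: P_def viz_ring_def)

lemma carrier_xv: "g \<in> VG \<Longrightarrow> h \<in> VH \<Longrightarrow> xv g h \<in> carrier P"
  unfolding xv_def by (rule carrier_Var) (auto simp: viz_vars_def)

lemma carrier_pairs: "g \<in> VG \<Longrightarrow> (\<Sum>T\<in>two_subsets VH. \<Prod>h\<in>T. xv g h) \<in> carrier P"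
  by (intro carrier_sum carrier_prod carrier_xv) (auto simp: two_subsets_def)

lemma carrier_cert_s0:
  "\<alpha> \<in> K \<Longrightarrow> \<beta> \<in> K \<Longrightarrow> \<gamma> \<in> K \<Longrightarrow> cert_s0 \<alpha> \<beta> \<gamma> VG VH \<in> carrier P"
  unfolding cert_s0_def
  by (intro carrier_add carrier_mult carrier_Const carrier_sum[of VG] carrier_sum[of VH]
      carrier_pairs carrier_xv)

lemma carrier_cert_s: "\<kappa> \<in> K \<Longrightarrow> \<mu> \<in> K \<Longrightarrow> g \<in> VG \<Longrightarrow> cert_s \<kappa> \<mu> VH g \<in> carrier P"
  unfolding cert_s_def
  by (intro carrier_add carrier_mult carrier_Const carrier_sum[of VH] carrier_pairs carrier_xv)

lemma carrier_viz_poly: "viz_poly VG DG VH DH \<in> carrier P"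
  unfolding viz_poly_def
  by (intro carrier_diff carrier_Const carrier_sum carrier_xv subfield_of_nat)

lemma certificate_congruence:
  fixes \<alpha> \<beta> \<gamma> \<kappa> \<mu> :: real
  assumes card_DG: "card DG = card VG - 1" "card DG \<ge> 1" and card_DH: "card DH = card VH - 1"
    and card_VH: "card VH \<in> {2, 3}"
    and two: "card VH = 2 \<Longrightarrow> \<alpha> = real (card VG) - 1 \<and> \<beta> = -1 \<and> \<gamma> = 1 \<and> \<kappa> = 0 \<and> \<mu> = 1"
    and three: "card VH = 3 \<Longrightarrow> \<alpha> = sqrt 2 * (real (card VG) - 1) \<and> \<beta> = - (2/3) * sqrt 2
      \<and> \<gamma> = 1/3 * sqrt 2 \<and> \<kappa> = 1/3 \<and> \<mu> = - (2/3)"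
    and K: "\<alpha> \<in> K" "\<beta> \<in> K" "\<gamma> \<in> K" "\<kappa> \<in> K" "\<mu> \<in> K"
  shows "congruent_mod (viz_poly VG DG VH DH)
    ((cert_s0 \<alpha> \<beta> \<gamma> VG VH)^2 + (\<Sum>g\<in>VG. (cert_s \<kappa> \<mu> VH g)^2)) (viz_ideal K VG DG VH DH)"
proof -
  define f where "f = viz_poly VG DG VH DH
    - ((cert_s0 \<alpha> \<beta> \<gamma> VG VH)^2 + (\<Sum>g\<in>VG. (cert_s \<kappa> \<mu> VH g)^2))"
  have f: "f \<in> carrier P"
    unfolding f_def power2_eq_square using K
    by (intro carrier_diff carrier_add carrier_mult carrier_sum carrier_viz_poly
        carrier_cert_s0 carrier_cert_s)
  \<comment> \<open>The generated ideal is the intersection of all ideals containing the generators,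
    so an arbitrary such \<open>I\<close> is treated.\<close>
  have "f \<in> I" if I: "ideal I P" and gens:
    "factor_generators eG VG DG \<subseteq> I" "factor_generators eH VH DH \<subseteq> I"
    "product_generators VG VH \<subseteq> I" for I
  proof (rule Boolean_ideal_membership[OF finite_viz_vars order_refl I f])
    fix v assume "v \<in> viz_vars VG VH"
    then consider g g' where "v = Edge_G {g, g'}" "g \<in> VG" "g' \<in> VG" "g \<noteq> g'"
      | h h' where "v = Edge_H {h, h'}" "h \<in> VH" "h' \<in> VH" "h \<noteq> h'"
      | g h where "v = Prod_Vertex g h" "g \<in> VG" "h \<in> VH"
      unfolding viz_vars_def two_subsets_def by (auto simp: card_2_iff)
    then show "(Var v)^2 - Var v \<in> I"
    proof cases
      case 1
      then have "(eG g g')^2 - eG g g' \<in> factor_generators eG VG DG"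
        unfolding factor_generators_def by blast
      then show ?thesis using 1 gens by (auto simp: eG_def)
    next
      case 2
      then have "(eH h h')^2 - eH h h' \<in> factor_generators eH VH DH"
        unfolding factor_generators_def by blast
      then show ?thesis using 2 gens by (auto simp: eH_def)
    next
      case 3
      then have "(xv g h)^2 - xv g h \<in> product_generators VG VH"
        unfolding product_generators_def by blast
      then show ?thesis using 3 gens by (auto simp: xv_def)
    qed
  next
    fix J assume J: "ideal J P" "I \<subseteq> J"
      and Boolean: "\<And>v. v \<in> viz_vars VG VH \<Longrightarrow> Var v \<in> J \<or> 1 - Var v \<in> J"
    interpret poly_over_ideal K "viz_vars VG VH" J
      by (intro poly_over_ideal.intro poly_over_axioms poly_over_ideal_axioms.intro J)
    show "f \<in> J"
    \<comment> \<open>An improper \<open>J\<close> contains everything; a proper one is a genuine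
      0/1 point.\<close>
    proof (cases "1 \<in> J")
      case True
      then show ?thesis using f by (rule one_in_J)
    next
      case False
      \<comment> \<open>The two graphs and the vertex set of the product encoded by the point: the
        variables of value 1.\<close>
      define EG where "EG g g' \<longleftrightarrow> 1 - Var (Edge_G {g, g'}) \<in> J" for g g'
      define EH where "EH h h' \<longleftrightarrow> 1 - Var (Edge_H {h, h'}) \<in> J" for h h'
      define Y where "Y g h \<longleftrightarrow> 1 - Var (Prod_Vertex g h) \<in> J" for g h
      have ev_eG: "evaluates (eG g g') (of_bool (EG g g'))" if "g \<in> VG" "g' \<in> VG" "g \<noteq> g'" for g g'
        unfolding eG_def EG_def using that
        by (intro evaluates_Var Boolean) (auto simp: viz_vars_def two_subsets_def)
      have ev_eH: "evaluates (eH h h') (of_bool (EH h h'))" if "h \<in> VH" "h' \<in> VH" "h \<noteq> h'" for h h'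
        unfolding eH_def EH_def using that
        by (intro evaluates_Var Boolean) (auto simp: viz_vars_def two_subsets_def)
      have ev_xv: "evaluates (xv g h) (of_bool (Y g h))" if "g \<in> VG" "h \<in> VH" for g h
        unfolding xv_def Y_def using that
        by (intro evaluates_Var Boolean) (auto simp: viz_vars_def)
      have gens_J: "factor_generators eG VG DG \<subseteq> J" "factor_generators eH VH DH \<subseteq> J"
        "product_generators VG VH \<subseteq> J" using gens J by auto
      note sem_G = factor_semantics[OF finite_VG DG_subset False gens_J(1) ev_eG]
      note sem_H = factor_semantics[OF finite_VH DH_subset False gens_J(2) ev_eH]
      have sym: "EG g g' \<Longrightarrow> EG g' g" "EH h h' \<Longrightarrow> EH h' h" for g g' h h'
        by (simp_all add: EG_def EH_def insert_commute)
      \<comment> \<open>The lower bounds on the cardinalities ensure that the natural-number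
        subtractions are not truncated.\<close>
      have card_Suc: "card VG = Suc (card DG)" "card VH = Suc (card DH)"
        using card_DG card_DH card_VH by auto
      obtain a b where edge_G: "a \<in> VG" "b \<in> VG" "a \<noteq> b"
        "\<forall>u\<in>VG. \<forall>v\<in>VG. u \<noteq> v \<longrightarrow> (EG u v \<longleftrightarrow> {u, v} = {a, b})"
        by (rule unique_edge[OF finite_VG DG_subset card_Suc(1) sym(1) sem_G])
      obtain c d where edge_H: "c \<in> VH" "d \<in> VH" "c \<noteq> d"
        "\<forall>u\<in>VH. \<forall>v\<in>VH. u \<noteq> v \<longrightarrow> (EH u v \<longleftrightarrow> {u, v} = {c, d})"
        by (rule unique_edge[OF finite_VH DH_subset card_Suc(2) sym(2) sem_H])
      interpret one_edge_dominated VG VH a b c d Y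
      proof unfold_locales
        fix g h assume gh: "g \<in> VG" "h \<in> VH"
        \<comment> \<open>The value of this generator is zero, so \<open>(g, h)\<close> is chosen or
          has a chosen neighbour in its column or row; uniqueness of the edges then names that
          neighbour.\<close>
        have "evaluates ((1 - xv g h) * (\<Prod>g'\<in>VG - {g}. (1 - eG g g' * xv g' h))
            * (\<Prod>h'\<in>VH - {h}. (1 - eH h h' * xv g h')))
          ((1 - of_bool (Y g h)) * (\<Prod>g'\<in>VG - {g}. (1 - of_bool (EG g g') * of_bool (Y g' h)))
            * (\<Prod>h'\<in>VH - {h}. (1 - of_bool (EH h h') * of_bool (Y g h'))))"
          using gh by (intro evaluates_intros ev_eG ev_eH ev_xv) auto
        moreover have "(1 - xv g h) * (\<Prod>g'\<in>VG - {g}. (1 - eG g g' * xv g' h))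
            * (\<Prod>h'\<in>VH - {h}. (1 - eH h h' * xv g h')) \<in> J"
          using gens_J(3) gh unfolding product_generators_def by blast
        ultimately have "(1 - of_bool (Y g h))
            * (\<Prod>g'\<in>VG - {g}. (1 - of_bool (EG g g') * of_bool (Y g' h)))
            * (\<Prod>h'\<in>VH - {h}. (1 - of_bool (EH h h') * of_bool (Y g h'))) = (0 :: real)"
          using evaluates_in_J False by blast
        moreover have "1 - of_bool p = (0::real) \<longleftrightarrow> p"
          "1 - of_bool p * of_bool q = (0::real) \<longleftrightarrow> p \<and> q" for p q by auto
        ultimately consider "Y g h" | g' where "g' \<in> VG - {g}" "EG g g'" "Y g' h"
          | h' where "h' \<in> VH - {h}" "EH h h'" "Y g h'"
          using finite_VG finite_VH
          by (simp only: mult_eq_0_iff prod_zero_iff finite_Diff) blast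
        then show "Y g h \<or> g = a \<and> Y b h \<or> g = b \<and> Y a h \<or> h = c \<and> Y g d \<or> h = d \<and> Y g c"
        proof cases
          case 2
          with edge_G(4)[rule_format, of g g'] gh have "{g, g'} = {a, b}" by auto
          with 2 show ?thesis by (auto simp: doubleton_eq_iff)
        next
          case 3
          with edge_H(4)[rule_format, of h h'] gh have "{h, h'} = {c, d}" by auto
          with 3 show ?thesis by (auto simp: doubleton_eq_iff)
        qed simp
      qed (use finite_VG finite_VH edge_G edge_H in auto)
      have sum_row: "(\<Sum>h\<in>VH. of_bool (Y g h)) = real (card (row g))" for g
        using finite_VH by (simp add: row_def Int_def)
      have pairs_row: "(\<Sum>T\<in>two_subsets VH. \<Prod>h\<in>T. of_bool (Y g h)) = real (card (row g) choose 2)" for g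
        using sum_two_subsets_of_bool[OF finite_VH] by (simp add: row_def)
      have ev_row: "evaluates (\<Sum>h\<in>VH. xv g h) (real (card (row g)))" if "g \<in> VG" for g
        unfolding sum_row[symmetric] using that by (intro evaluates_sum ev_xv)
      have ev_pairs: "evaluates (\<Sum>T\<in>two_subsets VH. \<Prod>h\<in>T. xv g h) (real (card (row g) choose 2))"
        if "g \<in> VG" for g
        unfolding pairs_row[symmetric] using that
        by (intro evaluates_sum evaluates_prod ev_xv) (auto simp: two_subsets_def)
      have "evaluates f ((\<Sum>g\<in>VG. real (card (row g))) - real (card DG * card DH)
        - ((\<alpha> + \<beta> * (\<Sum>g\<in>VG. real (card (row g))) + \<gamma> * (\<Sum>g\<in>VG. real (card (row g) choose 2)))^2
           + (\<Sum>g\<in>VG. (\<kappa> * real (card (row g)) + \<mu> * real (card (row g) choose 2))^2)))"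
        unfolding f_def viz_poly_def cert_s0_def cert_s_def
        using K by (intro evaluates_Const evaluates_add evaluates_diff evaluates_mult evaluates_power2
          evaluates_sum[of VG] ev_row ev_pairs subfield_of_nat)
      moreover have "(\<Sum>g\<in>VG. real (card (row g))) - real (card DG * card DH)
        - ((\<alpha> + \<beta> * (\<Sum>g\<in>VG. real (card (row g))) + \<gamma> * (\<Sum>g\<in>VG. real (card (row g) choose 2)))^2
           + (\<Sum>g\<in>VG. (\<kappa> * real (card (row g)) + \<mu> * real (card (row g) choose 2))^2)) = 0"
        using certificate_rows[OF card_VH two three] card_DG card_DH by simp
      ultimately show "f \<in> J" by (simp add: evaluates_zero_in_J)
    qed
  qed
  then show ?thesis
    by (auto simp: congruent_mod_def viz_ideal_def genideal_def f_def P_eq_viz_ring)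
qed

end

section \<open>Degrees and domination numbers\<close>

lemma monomial_degree_add:
  "(\<Sum>v\<in>Poly_Mapping.keys (m + n). Poly_Mapping.lookup (m + n) v) =
   (\<Sum>v\<in>Poly_Mapping.keys m. Poly_Mapping.lookup m v) + (\<Sum>v\<in>Poly_Mapping.keys n. Poly_Mapping.lookup n v)"
  for m n :: "'v \<Rightarrow>\<^sub>0 nat"
proof -
  \<comment> \<open>Both exponent vectors are summed over one common finite set, where lookups
    outside their own supports are zero.\<close>
  let ?U = "Poly_Mapping.keys m \<union> Poly_Mapping.keys n"
  have ext: "(\<Sum>v\<in>Poly_Mapping.keys k. Poly_Mapping.lookup k v) = (\<Sum>v\<in>?U. Poly_Mapping.lookup k v)"
    if "Poly_Mapping.keys k \<subseteq> ?U" for k :: "'v \<Rightarrow>\<^sub>0 nat"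
    using that by (intro sum.mono_neutral_left) (auto simp: in_keys_iff)
  show ?thesis
    unfolding ext[OF keys_add] ext[OF Un_upper1] ext[OF Un_upper2]
    by (simp add: lookup_add sum.distrib)
qed

lemma total_degree_le_iff:
  "total_degree p \<le> d \<longleftrightarrow>
   (\<forall>m\<in>Poly_Mapping.keys p. (\<Sum>v\<in>Poly_Mapping.keys m. Poly_Mapping.lookup m v) \<le> d)"
  unfolding total_degree_def by (subst Max_le_iff) auto

lemma total_degree_0 [simp]: "total_degree 0 = 0"
  by (simp add: total_degree_def)

lemma total_degree_add: "total_degree p \<le> d \<Longrightarrow> total_degree q \<le> d \<Longrightarrow> total_degree (p + q) \<le> d"
  using keys_add[of p q] unfolding total_degree_le_iff by blast

lemma total_degree_sum:
  "(\<And>i. i \<in> A \<Longrightarrow> total_degree (f i) \<le> d) \<Longrightarrow> total_degree (sum f A) \<le> d"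
  by (induction A rule: infinite_finite_induct) (auto intro: total_degree_add)

lemma total_degree_mult:
  assumes "total_degree p \<le> d" "total_degree q \<le> e" shows "total_degree (p * q) \<le> d + e"
  unfolding total_degree_le_iff
proof
  fix m assume "m \<in> Poly_Mapping.keys (p * q)"
  then obtain a b where "a \<in> Poly_Mapping.keys p" "b \<in> Poly_Mapping.keys q" "m = a + b"
    using keys_mult[of p q] by blast
  then show "(\<Sum>v\<in>Poly_Mapping.keys m. Poly_Mapping.lookup m v) \<le> d + e"
    using assms by (auto simp: total_degree_le_iff monomial_degree_add intro!: add_mono)
qed

lemma total_degree_Const: "total_degree (Const c) = 0"
  by (simp add: total_degree_def Const_def)

lemma total_degree_Const_mult: "total_degree p \<le> d \<Longrightarrow> total_degree (Const c * p) \<le> d"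
  using total_degree_mult[of "Const c" 0 p d] by (simp add: total_degree_Const)

lemma total_degree_xv: "total_degree (xv g h) = 1"
  by (simp add: total_degree_def xv_def Var_def)

lemma total_degree_pairs: "total_degree (\<Sum>T\<in>two_subsets VH. \<Prod>h\<in>T. xv g h) \<le> 2"
proof (rule total_degree_sum)
  fix T assume "T \<in> two_subsets VH"
  then obtain h h' where "T = {h, h'}" "h \<noteq> h'" by (auto simp: two_subsets_def card_2_iff)
  then show "total_degree (\<Prod>h\<in>T. xv g h) \<le> 2"
    using total_degree_mult[of "xv g h" 1 "xv g h'" 1] by (simp add: total_degree_xv)
qed

lemma total_degree_cert_s0: "total_degree (cert_s0 \<alpha> \<beta> \<gamma> VG VH) \<le> 2"
  unfolding cert_s0_def
  by (intro total_degree_add total_degree_Const_mult total_degree_sum[of VG] total_degree_sum[of VH]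
      total_degree_pairs) (simp_all add: total_degree_Const total_degree_xv)

lemma total_degree_cert_s: "total_degree (cert_s \<kappa> \<mu> VH g) \<le> 2"
  unfolding cert_s_def
  by (intro total_degree_add total_degree_Const_mult total_degree_sum[of VH] total_degree_pairs)
    (simp add: total_degree_xv)

section \<open>Domination numbers and Vizing's inequality\<close>

lemma finite_dominating_sets: "finite (pverts G) \<Longrightarrow> finite {D. dominating_set G D}"
  by (rule finite_subset[of _ "Pow (pverts G)"]) (auto simp: dominating_set_def)

lemma domination_number_le:
  "finite (pverts G) \<Longrightarrow> dominating_set G D \<Longrightarrow> domination_number G \<le> card D"
  unfolding domination_number_def by (intro Min_le) (auto simp: finite_dominating_sets)

lemma domination_number_attained:
  assumes "finite (pverts G)"
  obtains D where "dominating_set G D" "card D = domination_number G"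
proof -
  have "dominating_set G (pverts G)" by (simp add: dominating_set_def)
  then have "domination_number G \<in> card ` {D. dominating_set G D}"
    unfolding domination_number_def using assms by (intro Min_in) (auto simp: finite_dominating_sets)
  then show thesis using that by auto
qed

text \<open>A minimum dominating set serves as the distinguished set of \<open>unique_edge\<close>:
  it misses exactly one vertex, and by minimality no set with one element less dominates.\<close>

lemma unique_arc:
  assumes "pair_graph G" "card (pverts G) = n" "n \<ge> 2" "domination_number G = n - 1"
  obtains a b where "a \<in> pverts G" "b \<in> pverts G" "a \<noteq> b"
    and "\<And>u v. (u, v) \<in> parcs G \<Longrightarrow> {u, v} = {a, b}"
proof -
  interpret pair_graph G by fact
  have fin: "finite (pverts G)" by (rule pair_finite_verts)
  obtain D where D: "dominating_set G D" "card D = domination_number G"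
    using domination_number_attained[OF fin] .
  have sym: "(v, u) \<in> parcs G" if "(u, v) \<in> parcs G" for u v
    using that by (rule arcs_symmetric)
  obtain a b where ab: "a \<in> pverts G" "b \<in> pverts G" "a \<noteq> b"
    "\<forall>u\<in>pverts G. \<forall>v\<in>pverts G. u \<noteq> v \<longrightarrow> ((u, v) \<in> parcs G \<longleftrightarrow> {u, v} = {a, b})"
  proof (rule unique_edge[of "pverts G" D "\<lambda>u v. (u, v) \<in> parcs G"])
    show "\<exists>u\<in>D. (v, u) \<in> parcs G" if "v \<in> pverts G - D" for v
      using D(1) that sym unfolding dominating_set_def by blast
    show "\<exists>v\<in>pverts G - S. \<forall>u\<in>S. (u, v) \<notin> parcs G"
      if S: "S \<subseteq> pverts G" "card S = card D - 1" for S
    proof -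
      \<comment> \<open>As \<open>n \<ge> 2\<close>, the minimum is positive and
        \<open>card D - 1\<close> is strictly smaller.\<close>
      have "\<not> dominating_set G S"
        using domination_number_le[OF fin, of S] S(2) D(2) assms(2-4) by auto
      then show ?thesis using S(1) by (auto simp: dominating_set_def)
    qed
  qed (use fin D assms(2-4) sym in \<open>auto simp: dominating_set_def\<close>)
  have "{u, v} = {a, b}" if uv: "(u, v) \<in> parcs G" for u v
    using ab(4)[rule_format, of u v] uv pair_no_loops[OF uv] arc_fst_in_verts[OF uv] arc_snd_in_verts[OF uv] by simp
  with ab(1-3) show thesis by (rule that)
qed

text \<open>Both factors have a single edge, so a minimum dominating set of the product is an
  instance of \<open>one_edge_dominated\<close>, and its size is the sum of its row sizes.\<close>

lemma Vizing_inequality: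
  assumes G: "pair_graph G" "card (pverts G) = m" "m \<ge> 2" "domination_number G = m - 1"
    and H: "pair_graph H" "card (pverts H) = n" "n \<ge> 2" "domination_number H = n - 1"
  shows "domination_number G * domination_number H \<le> domination_number (cartesian_product G H)"
proof -
  \<comment> \<open>Infinite sets have cardinality 0, so a cardinality of at least 2 forces
    finiteness.\<close>
  have fin: "finite (pverts G)" "finite (pverts H)" using G(2,3) H(2,3) card.infinite by fastforce+
  obtain a b where ab: "a \<in> pverts G" "b \<in> pverts G" "a \<noteq> b"
    "\<And>u v. (u, v) \<in> parcs G \<Longrightarrow> {u, v} = {a, b}" using unique_arc[OF G] by metis
  obtain c d where cd: "c \<in> pverts H" "d \<in> pverts H" "c \<noteq> d"
    "\<And>u v. (u, v) \<in> parcs H \<Longrightarrow> {u, v} = {c, d}" using unique_arc[OF H] by metis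
  have "finite (pverts (cartesian_product G H))" by (simp add: cartesian_product_def fin)
  then obtain D where D: "dominating_set (cartesian_product G H) D"
    "card D = domination_number (cartesian_product G H)"
    by (rule domination_number_attained)
  interpret one_edge_dominated "pverts G" "pverts H" a b c d "\<lambda>g h. (g, h) \<in> D"
  proof unfold_locales
    fix g h assume gh: "g \<in> pverts G" "h \<in> pverts H"
    have "(g, h) \<in> D \<or> (\<exists>h'. (h', h) \<in> parcs H \<and> (g, h') \<in> D) \<or> (\<exists>g'. (g', g) \<in> parcs G \<and> (g', h) \<in> D)"
      using D(1) gh unfolding dominating_set_def cartesian_product_def by fastforce
    then show "(g, h) \<in> D \<or> g = a \<and> (b, h) \<in> D \<or> g = b \<and> (a, h) \<in> D
        \<or> h = c \<and> (g, d) \<in> D \<or> h = d \<and> (g, c) \<in> D"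
      by (elim disjE exE conjE) (auto dest!: ab(4) cd(4) simp: doubleton_eq_iff)
  qed (use fin ab cd in auto)
  have "D = (SIGMA g:pverts G. row g)"
    using D(1) by (auto simp: dominating_set_def cartesian_product_def row_def)
  from arg_cong[OF this, of card] have "card D = (\<Sum>g\<in>pverts G. card (row g))"
    by (rule trans) (rule card_SigmaI, use fin(1) finite_row in auto)
  then show ?thesis using card_rows_ge G H D(2) by simp
qed

theorem theorem6p7:
  fixes nG kG nH kH :: nat and \<alpha> \<beta> \<gamma> \<kappa> \<mu> :: real
  assumes "kG = nG - 1" and "kG \<ge> 1"
    and "nH \<in> {2, 3}" and "kH = nH - 1"
    and "nH = 2 \<Longrightarrow> \<alpha> = real nG - 1 \<and> \<beta> = -1 \<and> \<gamma> = 1 \<and> \<kappa> = 0 \<and> \<mu> = 1"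
    and "nH = 3 \<Longrightarrow> \<alpha> = sqrt 2 * (real nG - 1) \<and> \<beta> = - (2/3) * sqrt 2 \<and> \<gamma> = 1/3 * sqrt 2
                  \<and> \<kappa> = 1/3 \<and> \<mu> = - (2/3)"
  shows "(\<forall>(K :: real set) (VG :: 'g set) DG (VH :: 'h set) DH.
            vizing_setting K VG DG VH DH \<and>
            card VG = nG \<and> card DG = kG \<and> card VH = nH \<and> card DH = kH \<longrightarrow>
            congruent_mod (viz_poly VG DG VH DH)
              ((cert_s0 \<alpha> \<beta> \<gamma> VG VH)^2 + (\<Sum>g\<in>VG. (cert_s \<kappa> \<mu> VH g)^2))
              (viz_ideal K VG DG VH DH) \<and>
            sos_certificate 2 (viz_ring K VG VH) (viz_ideal K VG DG VH DH) (viz_poly VG DG VH DH)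
              (insert None (Some ` VG))
              (case_option (cert_s0 \<alpha> \<beta> \<gamma> VG VH) (cert_s \<kappa> \<mu> VH)))
       \<and> (\<forall>(G :: 'a pair_pre_digraph) (H :: 'b pair_pre_digraph).
            pair_graph G \<and> card (pverts G) = nG \<and> domination_number G = nG - 1 \<and>
            pair_graph H \<and> card (pverts H) = nH \<and> domination_number H = nH - 1 \<longrightarrow>
            domination_number G * domination_number H
              \<le> domination_number (cartesian_product G H))"
proof (intro conjI allI impI; (elim conjE)?)
  fix K :: "real set" and VG DG :: "'g set" and VH DH :: "'h set"
  assume setting: "vizing_setting K VG DG VH DH"
    and cards: "card VG = nG" "card DG = kG" "card VH = nH" "card DH = kH"
  interpret vizing_setting K VG DG VH DH by (rule setting)
  \<comment> \<open>All coefficients are rational for \<open>nH = 2\<close>; for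
    \<open>nH = 3\<close> the membership of \<open>sqrt 2\<close> in \<open>K\<close>
    enters.\<close>
  have K: "\<alpha> \<in> K" "\<beta> \<in> K" "\<gamma> \<in> K" "\<kappa> \<in> K" "\<mu> \<in> K"
  proof -
    consider "nH = 2" | "nH = 3" using assms(3) by auto
    then have "\<alpha> \<in> K \<and> \<beta> \<in> K \<and> \<gamma> \<in> K \<and> \<kappa> \<in> K \<and> \<mu> \<in> K"
    proof cases
      case 1
      show ?thesis
        using assms(5)[OF 1] by (simp add: subfield_closed subfield_diff subfield_of_nat)
    next
      case 2
      note p = assms(6)[OF 2, THEN conjunct1] assms(6)[OF 2, THEN conjunct2]
      show ?thesis
        unfolding p(1) conjunct1[OF p(2)] conjunct1[OF conjunct2[OF p(2)]]
          conjunct1[OF conjunct2[OF conjunct2[OF p(2)]]] conjunct2[OF conjunct2[OF conjunct2[OF p(2)]]]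
        by (intro conjI subfield_intros sqrt2_K)
    qed
    then show "\<alpha> \<in> K" "\<beta> \<in> K" "\<gamma> \<in> K" "\<kappa> \<in> K" "\<mu> \<in> K" by auto
  qed
  show cong: "congruent_mod (viz_poly VG DG VH DH)
      ((cert_s0 \<alpha> \<beta> \<gamma> VG VH)^2 + (\<Sum>g\<in>VG. (cert_s \<kappa> \<mu> VH g)^2)) (viz_ideal K VG DG VH DH)"
    by (rule certificate_congruence) (fact assms[folded cards] K)+
  \<comment> \<open>The index \<open>None\<close> stands for \<open>s0\<close> and
    \<open>Some g\<close> for the polynomial of the vertex \<open>g\<close>, so the family of
    squares splits into the two displayed summands.\<close>
  have "(\<Sum>i\<in>insert None (Some ` VG).
      (case_option (cert_s0 \<alpha> \<beta> \<gamma> VG VH) (cert_s \<kappa> \<mu> VH) i)^2)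
      = (cert_s0 \<alpha> \<beta> \<gamma> VG VH)^2 + (\<Sum>g\<in>VG. (cert_s \<kappa> \<mu> VH g)^2)"
    using finite_VG by (simp add: sum.reindex image_iff)
  then show "sos_certificate 2 (viz_ring K VG VH) (viz_ideal K VG DG VH DH) (viz_poly VG DG VH DH)
      (insert None (Some ` VG)) (case_option (cert_s0 \<alpha> \<beta> \<gamma> VG VH) (cert_s \<kappa> \<mu> VH))"
    using cong K finite_VG unfolding sos_certificate_def P_eq_viz_ring[symmetric]
    by (auto simp: carrier_cert_s0 carrier_cert_s total_degree_cert_s0 total_degree_cert_s)
next
  fix G :: "'a pair_pre_digraph" and H :: "'b pair_pre_digraph"
  assume "pair_graph G" "card (pverts G) = nG" "domination_number G = nG - 1"
    and "pair_graph H" "card (pverts H) = nH" "domination_number H = nH - 1"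
  moreover have "nG \<ge> 2" "nH \<ge> 2" using assms(1-3) by auto
  ultimately show "domination_number G * domination_number H
      \<le> domination_number (cartesian_product G H)"
    using Vizing_inequality by blast
qed

end
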